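(* Let $S:\mathbb{A}\to\mathbb{A}$ be a Fréchet differentiable solution of $S(x+S(x)y)=S(x)S(y)$ ($x,y\in\mathbb{G}_S^*$), and let the continuous map $N:\mathbb{G}_S^*\to\mathbb{A}$ solve the Goldie equation $$N(x+S(x)y)=N(x)+S(x)N(y)\qquad(x,y\in\mathbb{G}_S^* ).$$ For any $u\in\mathbb{A}$ such that $\gamma(u):=S'(0)u$ has a spectrum not separating $0$ from $\infty$, the following holds for all $t\ge0$: $$N\big(u(e^{t\gamma(u)}-1)/\gamma(u)\big)=\lambda_u(t)\,N\big(u(e^{\gamma(u)}-1)/\gamma(u)\big),\qquad \lambda_u(t):=(e^{t\gamma(u)}-1)/(e^{\gamma(u)}-1),$$ with the (L'Hospital) convention that, when $1\in\exp(\mathrm{spec}(\gamma(u)))$, this reads $N(tu)=tN(u)$ for $t\ge0$. Furthermore, the exponential tilting map $$T(u):=u\,\mu(\gamma(u))=u(e^{\gamma(u)}-1)/\gamma(u),\qquad T(tu)=\lambda_u(t)T(u)\quad(t\ge0),$$ has invertible multiplier $\mu(\gamma(u))$ for $u\in\mathbb{G}_S$, and satisfies $$N(T(tu))=N(\lambda_u(t)T(u))=\lambda_u(t)N(T(u))\qquad(t\ge0).$$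
   Context: $\mathbb{A}$ is a unital commutative real Banach algebra with identity $1=1_{\mathbb{A}}$. $\mathbb{A}^{-1}$ is the set of invertible elements, $\mathbb{A}_1$ the connected component of $1_{\mathbb{A}}$ in it; $\mathbb{G}_S^*=\{x:S(x)\in\mathbb{A}^{-1}\}$, $\mathbb{G}_S=\{x:S(x)\in\mathbb{A}_1\}$. Standing assumptions: $S$ continuous, $0,1_{\mathbb{A}}\in\mathbb{G}_S^*$ (so $S(0)=1_{\mathbb{A}}$). $\mathrm{spec}(a)\subseteq\mathbb{C}$ is the spectrum of $a$ (in the complexification of $\mathbb{A}$). It "does not separate $0$ from $\infty$" if $0$ lies in no bounded connected component of $\mathbb{C}\setminus\mathrm{spec}(a)$ (so that a logarithm is available on an unbounded connected open set as required for the functional calculus). $\mu$ is the entire function $\mu(z)=(e^z-1)/z$, $\mu(0)=1$; expressions such as $(e^{t\gamma(u)}-1)/\gamma(u)$ are understood through the holomorphic functional calculus (i.e. $(e^{tz}-1)/z$ is the entire function with value $t$ at $z=0$).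
   Formalization: If 1∈exp(spec γ(u)), the identities and invertibility of μ(γ(u)) are proved only when no 2πik, k≠0, lies in the spectrum, with λ_u(t)=((e^{tγ}-1)/γ)μ(γ)^{-1}; N(tu)=tN(u) is proved only for γ(u)=0; otherwise only the identity with denominator cleared. *)

theory Defs
  imports "HOL-Analysis.Analysis"
begin

text \<open>
  Throughout, a unital commutative real Banach algebra is a type of sort
  \<open>{banach, real_normed_algebra_1, comm_ring_1}\<close>; invertibility of \<open>a\<close> is \<open>a dvd 1\<close>.
\<close>

definition alg_units :: "'a::comm_ring_1 set" where
  "alg_units = {a. a dvd 1}"

text \<open>Meaningful only for \<open>a \<in> alg_units\<close>.\<close>

definition alg_inv :: "'a::comm_ring_1 \<Rightarrow> 'a" where
  "alg_inv a = (THE b. a * b = 1)"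

text \<open>
  The complexification: the pair \<open>(a, b)\<close> stands for \<open>a + i b\<close>, so that \<open>a - z 1\<close> is the pair
  \<open>(a - Re z, - Im z)\<close>.
\<close>

definition cx_mult :: "'a::comm_ring_1 \<times> 'a \<Rightarrow> 'a \<times> 'a \<Rightarrow> 'a \<times> 'a" where
  "cx_mult p q = (fst p * fst q - snd p * snd q, fst p * snd q + snd p * fst q)"

definition cx_invertible :: "'a::comm_ring_1 \<times> 'a \<Rightarrow> bool" where
  "cx_invertible p \<longleftrightarrow> (\<exists>q. cx_mult p q = (1, 0))"

definition spec :: "'a::{banach, real_normed_algebra_1, comm_ring_1} \<Rightarrow> complex set" where
  "spec a = {z. \<not> cx_invertible (a - of_real (Re z), - of_real (Im z))}"

definition separates_0_inf :: "complex set \<Rightarrow> bool" where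
  "separates_0_inf K \<longleftrightarrow> (\<exists>C \<in> components (- K). bounded C \<and> 0 \<in> C)"

text \<open>
  Holomorphic functional calculus for an entire function \<open>f\<close> that is real on the real axis:
  \<open>f(a)\<close> is the Taylor series of \<open>f\<close> at 0 evaluated at \<open>a\<close>. The Taylor coefficients of such \<open>f\<close>
  are real; \<open>Re\<close> only converts their type.
\<close>

definition entire_calc ::
  "(complex \<Rightarrow> complex) \<Rightarrow> 'a::{banach, real_normed_algebra_1, comm_ring_1} \<Rightarrow> 'a" where
  "entire_calc f a = (\<Sum>n. Re ((deriv ^^ n) f 0 / fact n) *\<^sub>R a ^ n)"

definition mu :: "complex \<Rightarrow> complex" where
  "mu z = (if z = 0 then 1 else (exp z - 1) / z)"

text \<open>The entire function \<open>(exp (t z) - 1) / z\<close>.\<close>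

definition exp_quot :: "real \<Rightarrow> complex \<Rightarrow> complex" where
  "exp_quot t z = (if z = 0 then of_real t else (exp (of_real t * z) - 1) / z)"

definition G_star :: "('a::{banach, real_normed_algebra_1, comm_ring_1} \<Rightarrow> 'a) \<Rightarrow> 'a set" where
  "G_star S = {x. S x \<in> alg_units}"

definition G_one :: "('a::{banach, real_normed_algebra_1, comm_ring_1} \<Rightarrow> 'a) \<Rightarrow> 'a set" where
  "G_one S = {x. S x \<in> connected_component_set alg_units 1}"

definition gamma ::
  "('a::{banach, real_normed_algebra_1, comm_ring_1} \<Rightarrow> 'a) \<Rightarrow> 'a \<Rightarrow> 'a" where
  "gamma S u = frechet_derivative S (at 0) u"

text \<open>
  The function \<open>(exp (t z) - 1) / (exp z - 1)\<close> of \<open>z\<close> has a removable singularity at 0, with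
  (L'Hospital) value \<open>t\<close> there, whereas at \<open>2 \<pi> i k\<close> with \<open>k \<noteq> 0\<close> it is in general singular.
  The following says that the spectrum meets its singular set at most in 0.
\<close>

definition removable :: "'a::{banach, real_normed_algebra_1, comm_ring_1} \<Rightarrow> bool" where
  "removable a \<longleftrightarrow> (\<forall>z \<in> spec a. exp z = 1 \<longrightarrow> z = 0)"

text \<open>
  The second branch is the L'Hospital convention: it evaluates the function above as the quotient
  of the entire functions \<open>exp_quot t\<close> (equal to \<open>t\<close> at 0) and \<open>mu\<close> (equal to 1 at 0).
\<close>

definition lam ::
  "('a::{banach, real_normed_algebra_1, comm_ring_1} \<Rightarrow> 'a) \<Rightarrow> 'a \<Rightarrow> real \<Rightarrow> 'a" where
  "lam S u t =
     (if 1 \<notin> exp ` spec (gamma S u)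
      then (exp (t *\<^sub>R gamma S u) - 1) * alg_inv (exp (gamma S u) - 1)
      else entire_calc (exp_quot t) (gamma S u) * alg_inv (entire_calc mu (gamma S u)))"

text \<open>The exponential tilting map.\<close>

definition tilt ::
  "('a::{banach, real_normed_algebra_1, comm_ring_1} \<Rightarrow> 'a) \<Rightarrow> 'a \<Rightarrow> 'a" where
  "tilt S u = u * entire_calc mu (gamma S u)"

end

theory Submission
  imports Defs
begin

text \<open>
  Write \<open>c = \<gamma> u\<close> and \<open>\<phi> t = (e\<^bsup>tc\<^esup> - 1) / c\<close>. The functional equation forces
  \<open>S (u \<phi> t) = e\<^bsup>tc\<^esup>\<close>, so that \<open>\<phi> (s + t) = \<phi> s + e\<^bsup>sc\<^esup> \<phi> t\<close> turns the Goldie equation into the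
  cocycle equation \<open>n (s + t) = n s + e\<^bsup>sc\<^esup> n t\<close> for \<open>n t = N (u \<phi> t)\<close>; its continuous solutions
  satisfy \<open>\<phi> 1 n t = \<phi> t n 1\<close>. Finally \<open>\<mu> c = \<phi> 1\<close> is invertible as soon as the spectrum of \<open>c\<close>
  avoids the zeros \<open>2 \<pi> i k\<close>, \<open>k \<noteq> 0\<close>, of \<open>\<mu>\<close>; this is shown inside the real algebra by duplication
  formulas, without Gelfand theory.
\<close>

subsection \<open>The entire functions \<open>exp_quot t\<close>\<close>

text \<open>\<open>entire_calc\<close> is defined through iterated derivatives at 0, so the Taylor
  coefficients have to be identified. They are those of \<open>exp (t z) - 1\<close> moved down one
  index, since dividing by \<open>z\<close> shifts the series.\<close>

lemma exp_quot_has_fps_expansion: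
  "exp_quot t has_fps_expansion Abs_fps (\<lambda>n. of_real t ^ Suc n / fact (Suc n))"
\<comment> \<open>At \<open>t = 0\<close> the series \<open>fps_exp t - 1\<close> is zero and has
  subdegree 0, so no shift by one is available.\<close>
proof (cases "t = 0")
  case True
  then have "exp_quot t = (\<lambda>_. 0)" "Abs_fps (\<lambda>n. of_real t ^ Suc n / fact (Suc n) :: complex) = 0"
    by (auto simp: exp_quot_def fun_eq_iff fps_eq_iff)
  then show ?thesis by simp
next
  case False
  let ?F = "fps_exp (of_real t :: complex) - 1"
  have nz: "?F \<noteq> 0" using False by (auto simp: fps_eq_iff intro!: exI[of _ 1])
  have "(\<lambda>z. if z = 0 then of_real t else (exp (of_real t * z) - 1) / z ^ 1)
          has_fps_expansion fps_shift 1 ?F"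
    by (intro has_fps_expansion_shift has_fps_expansion_diff has_fps_expansion_exp
        has_fps_expansion_1 subdegree_geI nz) (auto simp: False)
  moreover have "fps_shift 1 ?F = Abs_fps (\<lambda>n. of_real t ^ Suc n / fact (Suc n))"
    by (auto simp: fps_eq_iff algebra_simps)
  ultimately show ?thesis by (simp add: exp_quot_def[abs_def] del: fact_Suc power_Suc cong: if_cong)
qed

lemma mu_eq_exp_quot: "mu = exp_quot 1"
  by (auto simp: mu_def exp_quot_def fun_eq_iff)

lemma entire_calc_exp_quot_series:
  "entire_calc (exp_quot t) c = (\<Sum>n. (t ^ Suc n / fact (Suc n)) *\<^sub>R c ^ n)"
proof -
  have "Re ((deriv ^^ n) (exp_quot t) 0 / fact n) = t ^ Suc n / fact (Suc n)" for n
  proof -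
    have "(deriv ^^ n) (exp_quot t) 0 / fact n = of_real t ^ Suc n / fact (Suc n)"
      using fps_nth_fps_expansion[OF exp_quot_has_fps_expansion[of t], of n] by simp
    also have "\<dots> = of_real (t ^ Suc n / fact (Suc n))" by simp
    finally show ?thesis using Re_complex_of_real by metis
  qed
  then show ?thesis by (simp add: entire_calc_def)
qed

lemma exp_quot_series_sums:
  fixes c :: "'a::{banach, real_normed_algebra_1, comm_ring_1}"
  shows "(\<lambda>n. (t ^ Suc n / fact (Suc n)) *\<^sub>R c ^ n) sums entire_calc (exp_quot t) c"
  unfolding entire_calc_exp_quot_series
proof (rule summable_sums, rule summable_comparison_test)
  show "summable (\<lambda>n. \<bar>t\<bar> * ((\<bar>t\<bar> * norm c) ^ n /\<^sub>R fact n))"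
    by (intro summable_mult summable_exp_generic)
  show "\<exists>N. \<forall>n\<ge>N. norm ((t ^ Suc n / fact (Suc n)) *\<^sub>R c ^ n)
           \<le> \<bar>t\<bar> * ((\<bar>t\<bar> * norm c) ^ n /\<^sub>R fact n)"
  proof (intro exI allI impI)
    fix n :: nat
    have "norm ((t ^ Suc n / fact (Suc n)) *\<^sub>R c ^ n) = \<bar>t\<bar> ^ Suc n / fact (Suc n) * norm (c ^ n)"
      by (simp add: power_abs abs_mult)
    also have "\<dots> \<le> \<bar>t\<bar> ^ Suc n / fact n * norm c ^ n"
      by (intro mult_mono divide_left_mono norm_power_ineq) (auto simp del: fact_Suc intro!: fact_mono)
    finally show "norm ((t ^ Suc n / fact (Suc n)) *\<^sub>R c ^ n)
        \<le> \<bar>t\<bar> * ((\<bar>t\<bar> * norm c) ^ n /\<^sub>R fact n)"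
      by (simp add: power_mult_distrib field_simps)
  qed
qed

text \<open>This is \<open>t mu (t z) = (exp (t z) - 1) / z\<close>. It places
  \<open>tilt S (t u)\<close> on the curve \<open>u \<phi> t\<close> and enters the duplication
  formula for \<open>mu\<close>.\<close>

lemma scale_exp_quot:
  fixes c :: "'a::{banach, real_normed_algebra_1, comm_ring_1}"
  shows "t *\<^sub>R entire_calc (exp_quot 1) (t *\<^sub>R c) = entire_calc (exp_quot t) c"
proof -
  have "(\<lambda>n. t *\<^sub>R ((1 ^ Suc n / fact (Suc n)) *\<^sub>R (t *\<^sub>R c) ^ n))
      sums (t *\<^sub>R entire_calc (exp_quot 1) (t *\<^sub>R c))"
    by (intro sums_scaleR_right exp_quot_series_sums)
  also have "(\<lambda>n. t *\<^sub>R ((1 ^ Suc n / fact (Suc n)) *\<^sub>R (t *\<^sub>R c) ^ n))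
     = (\<lambda>n. (t ^ Suc n / fact (Suc n)) *\<^sub>R c ^ n)"
    by (auto simp: fun_eq_iff scaleR_power)
  finally show ?thesis using exp_quot_series_sums sums_unique2 by blast
qed

lemma exp_quot_at_0:
  "entire_calc (exp_quot 0) (c::'a::{banach, real_normed_algebra_1, comm_ring_1}) = 0"
  by (simp add: entire_calc_exp_quot_series)

lemma exp_quot_zero_arg:
  "entire_calc (exp_quot t) (0::'a::{banach, real_normed_algebra_1, comm_ring_1}) = of_real t"
proof -
  have "(\<lambda>n. (t ^ Suc n / fact (Suc n)) *\<^sub>R (0::'a) ^ n) sums ((t ^ Suc 0 / fact (Suc 0)) *\<^sub>R 0 ^ 0)"
    using sums_finite[of "{0}" "\<lambda>n. (t ^ Suc n / fact (Suc n)) *\<^sub>R (0::'a) ^ n"]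
    by (simp del: fact_Suc power_Suc add: power_0_left)
  then show ?thesis using exp_quot_series_sums[of t "0::'a"] sums_unique2
    by (fastforce simp: of_real_def)
qed

text \<open>Multiplying the series by \<open>c\<close> restores the exponential series without its
  constant term. This replaces division by \<open>c\<close>, which may be a zero divisor.\<close>

lemma exp_quot_times_arg:
  fixes c :: "'a::{banach, real_normed_algebra_1, comm_ring_1}"
  shows "c * entire_calc (exp_quot t) c = exp (t *\<^sub>R c) - 1"
proof -
  have "(\<lambda>n. c * ((t ^ Suc n / fact (Suc n)) *\<^sub>R c ^ n)) sums (c * entire_calc (exp_quot t) c)"
    by (intro sums_mult exp_quot_series_sums)
  also have "(\<lambda>n. c * ((t ^ Suc n / fact (Suc n)) *\<^sub>R c ^ n))
      = (\<lambda>n. (t *\<^sub>R c) ^ Suc n /\<^sub>R fact (Suc n))"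
    by (auto simp: fun_eq_iff scaleR_power field_simps)
  finally have "(\<lambda>n. (t *\<^sub>R c) ^ n /\<^sub>R fact n) sums (c * entire_calc (exp_quot t) c + 1)"
    by (subst (asm) sums_Suc_iff) auto
  then show ?thesis using exp_converges sums_unique2
    by (metis add_diff_cancel_right')
qed

text \<open>The term-by-term derivative is the exponential series, which converges uniformly on a
  bounded interval around \<open>t\<close>.\<close>

lemma exp_quot_has_vector_derivative:
  fixes c :: "'a::{banach, real_normed_algebra_1, comm_ring_1}"
  shows "((\<lambda>t. entire_calc (exp_quot t) c) has_vector_derivative exp (t *\<^sub>R c)) (at t)"
proof -
  define R where "R = \<bar>t\<bar> + 1"
  let ?S = "{-R<..<R}"
  let ?f = "\<lambda>n s. (s ^ Suc n / fact (Suc n)) *\<^sub>R c ^ n"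
  let ?f' = "\<lambda>n s. (s *\<^sub>R c) ^ n /\<^sub>R fact n"
  have f': "(?f n has_derivative (\<lambda>h. h *\<^sub>R ?f' n s)) (at s within ?S)" for n s
  proof -
    have "((\<lambda>s. s ^ Suc n / fact (Suc n)) has_field_derivative (s ^ n / fact n)) (at s within ?S)"
      using DERIV_cdivide[OF DERIV_pow[of "Suc n" s ?S], of "fact (Suc n)"] by simp
    then have "(?f n has_vector_derivative (s ^ n / fact n) *\<^sub>R c ^ n) (at s within ?S)"
      by (intro derivative_eq_intros) auto
    then show ?thesis
      by (simp add: has_vector_derivative_def scaleR_power field_simps)
  qed
  have unif: "uniform_limit ?S (\<lambda>n s. \<Sum>i<n. ?f' i s) (\<lambda>s. \<Sum>i. ?f' i s) sequentially"
  proof (rule Weierstrass_m_test)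
    show "norm (?f' n s) \<le> (R * norm c) ^ n /\<^sub>R fact n" if "s \<in> ?S" for n s
    proof -
      have "norm (y ^ n /\<^sub>R fact n) \<le> norm y ^ n /\<^sub>R fact n" for y :: 'a
        by (simp add: norm_power_ineq mult_left_mono)
      then have "norm (?f' n s) \<le> (norm (s *\<^sub>R c)) ^ n /\<^sub>R fact n" .
      also have "\<dots> \<le> (R * norm c) ^ n /\<^sub>R fact n"
        using that by (auto intro!: mult_left_mono power_mono mult_right_mono)
      finally show ?thesis .
    qed
    show "summable (\<lambda>n. (R * norm c) ^ n /\<^sub>R fact n)" by (rule summable_exp_generic)
  qed
  have "\<exists>g. \<forall>s\<in>?S. (\<lambda>n. ?f n s) sums g s \<and> (g has_derivative (\<lambda>h. h *\<^sub>R (\<Sum>i. ?f' i s))) (at s within ?S)"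
  proof (rule has_derivative_series[OF _ f'])
    fix e :: real assume "e > 0"
    from uniform_limitD[OF unif this]
    show "\<forall>\<^sub>F n in sequentially. \<forall>s\<in>?S. \<forall>h. norm ((\<Sum>i<n. h *\<^sub>R ?f' i s) - h *\<^sub>R (\<Sum>i. ?f' i s)) \<le> e * norm h"
    proof eventually_elim
      case (elim n)
      show ?case
      proof (intro ballI allI)
        fix s h assume "s \<in> ?S"
        have "norm ((\<Sum>i<n. h *\<^sub>R ?f' i s) - h *\<^sub>R (\<Sum>i. ?f' i s))
           = \<bar>h\<bar> * norm ((\<Sum>i<n. ?f' i s) - (\<Sum>i. ?f' i s))"
          unfolding norm_scaleR[symmetric] scaleR_right_diff_distrib scaleR_right.sum ..
        also have "\<dots> \<le> \<bar>h\<bar> * e"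
          using elim \<open>s \<in> ?S\<close> by (intro mult_left_mono) (auto simp: dist_norm intro: less_imp_le)
        finally show "norm ((\<Sum>i<n. h *\<^sub>R ?f' i s) - h *\<^sub>R (\<Sum>i. ?f' i s)) \<le> e * norm h"
          by (simp add: mult.commute)
      qed
    qed
  next
    show "t \<in> ?S" by (auto simp: R_def)
    show "(\<lambda>n. ?f n t) sums entire_calc (exp_quot t) c" by (rule exp_quot_series_sums)
  qed auto
  then obtain g where g: "\<And>s. s \<in> ?S \<Longrightarrow> (\<lambda>n. ?f n s) sums g s"
    "\<And>s. s \<in> ?S \<Longrightarrow> (g has_derivative (\<lambda>h. h *\<^sub>R (\<Sum>i. ?f' i s))) (at s within ?S)" by blast
  have t: "t \<in> ?S" by (auto simp: R_def)
  have eq: "g s = entire_calc (exp_quot s) c" if "s \<in> ?S" for s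
    using g(1)[OF that] exp_quot_series_sums sums_unique2 by blast
  have "(g has_derivative (\<lambda>h. h *\<^sub>R exp (t *\<^sub>R c))) (at t)"
    using g(2)[OF t] at_within_open[OF t] by (simp add: exp_def)
  then have "((\<lambda>t. entire_calc (exp_quot t) c) has_derivative (\<lambda>h. h *\<^sub>R exp (t *\<^sub>R c))) (at t)"
    by (rule has_derivative_transform_within_open[OF _ _ t]) (auto simp: eq)
  then show ?thesis by (simp add: has_vector_derivative_def)
qed

lemma exp_scaleR_add:
  fixes c :: "'a::{banach, real_normed_algebra_1, comm_ring_1}"
  shows "exp ((s + t) *\<^sub>R c) = exp (s *\<^sub>R c) * exp (t *\<^sub>R c)"
  by (simp add: scaleR_add_left exp_add_commuting mult.commute)

text \<open>For fixed \<open>s\<close> the difference of the two sides has derivative 0 in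
  \<open>t\<close> and vanishes at \<open>t = 0\<close>. Multiplying by \<open>c\<close> and
  cancelling would fail for a zero divisor \<open>c\<close>.\<close>

lemma exp_quot_add:
  fixes c :: "'a::{banach, real_normed_algebra_1, comm_ring_1}"
  shows "entire_calc (exp_quot (s + t)) c
     = entire_calc (exp_quot s) c + exp (s *\<^sub>R c) * entire_calc (exp_quot t) c"
proof -
  let ?\<phi> = "\<lambda>t. entire_calc (exp_quot t) c"
  let ?\<psi> = "\<lambda>t. ?\<phi> (s + t) - exp (s *\<^sub>R c) * ?\<phi> t"
  have "(?\<psi> has_vector_derivative 0) (at t)" for t
  proof -
    have "((?\<phi> \<circ> (+) s) has_vector_derivative 1 *\<^sub>R exp ((s + t) *\<^sub>R c)) (at t)"
      by (intro vector_diff_chain_at exp_quot_has_vector_derivative) (auto intro!: derivative_eq_intros)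
    then have "((\<lambda>t. ?\<phi> (s + t)) has_vector_derivative exp ((s + t) *\<^sub>R c)) (at t)"
      by (simp add: o_def)
    then show ?thesis
      by (auto intro!: derivative_eq_intros exp_quot_has_vector_derivative simp: exp_scaleR_add)
  qed
  then obtain k where "\<And>t. ?\<psi> t = k"
    using has_vector_derivative_zero_constant[of UNIV ?\<psi>] by auto
  from this[of 0] this[of t] show ?thesis by (simp add: exp_quot_at_0 algebra_simps)
qed

subsection \<open>Units\<close>

lemma unit_mult_iff:
  fixes a b :: "'a::comm_ring_1"
  shows "a * b dvd 1 \<longleftrightarrow> a dvd 1 \<and> b dvd 1"
  using mult_dvd_mono[of a 1 b 1] by (auto dest: dvd_mult_left dvd_mult_right)

lemma unit_mult_left_cancel:
  fixes a x y :: "'a::comm_ring_1"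
  assumes "a dvd 1" "a * x = a * y"
  shows "x = y"
proof -
  obtain b where "1 = a * b" using assms(1) by (rule dvdE)
  then have "x = b * (a * x)" "y = b * (a * y)" by (simp_all add: mult.commute flip: mult.assoc)
  then show ?thesis using assms(2) by simp
qed

text \<open>The Neumann series in \<open>1 - a\<close> is the inverse.\<close>

lemma near_one_imp_unit:
  fixes a :: "'a::{banach, real_normed_algebra_1, comm_ring_1}"
  assumes "norm (1 - a) < 1"
  shows "a dvd 1"
proof -
  let ?x = "1 - a"
  have s: "summable (\<lambda>n. ?x ^ n)" by (rule complete_algebra_summable_geometric[OF assms])
  have "?x * (\<Sum>n. ?x ^ n) = (\<Sum>n. ?x ^ Suc n)"
    by (simp add: suminf_mult[OF s])
  also have "\<dots> = (\<Sum>n. ?x ^ n) - 1" using suminf_split_head[OF s] by simp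
  finally have "1 = a * (\<Sum>n. ?x ^ n)" by (simp add: algebra_simps)
  then show ?thesis by (rule dvdI)
qed

lemma open_alg_units: "open (alg_units :: 'a::{banach, real_normed_algebra_1, comm_ring_1} set)"
  unfolding open_dist
proof
  fix a :: 'a assume "a \<in> alg_units"
  then obtain b where b: "1 = a * b" by (auto simp: alg_units_def dvd_def)
  have "y \<in> alg_units" if "dist y a < 1 / (norm b + 1)" for y
  proof -
    have "norm (1 - y * b) = norm ((a - y) * b)" using b by (simp add: algebra_simps)
    also have "\<dots> \<le> norm (a - y) * norm b" by (rule norm_mult_ineq)
    also have "\<dots> \<le> norm (a - y) * (norm b + 1)" by (simp add: mult_left_mono)
    also have "\<dots> < 1" using that
      by (simp add: dist_norm norm_minus_commute pos_less_divide_eq add_nonneg_pos)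
    finally show ?thesis using near_one_imp_unit unit_mult_iff by (auto simp: alg_units_def)
  qed
  moreover have "1 / (norm b + 1) > 0" by (simp add: add_nonneg_pos)
  ultimately show "\<exists>e>0. \<forall>y. dist y a < e \<longrightarrow> y \<in> alg_units" by blast
qed

lemma exp_unit: "exp (c::'a::{banach, real_normed_algebra_1, comm_ring_1}) dvd 1"
  using exp_minus_inverse[of c] by (metis dvd_triv_left)

subsection \<open>The solution \<open>S\<close> along exponential curves\<close>

lemma golab_schinzel_at_0:
  fixes S :: "'a::{banach, real_normed_algebra_1, comm_ring_1} \<Rightarrow> 'a"
  assumes "0 \<in> G_star S" "\<And>x y. x \<in> G_star S \<Longrightarrow> y \<in> G_star S \<Longrightarrow> S (x + S x * y) = S x * S y"
  shows "S 0 = 1"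
proof (rule unit_mult_left_cancel)
  show "S 0 dvd 1" using assms(1) by (simp add: G_star_def alg_units_def)
  show "S 0 * S 0 = S 0 * 1" using assms(2)[OF assms(1) assms(1)] by simp
qed

text \<open>Both sides of the functional equation are differentiated in \<open>y\<close> at
  \<open>y = 0\<close>. As \<open>S x\<close> is a unit, every direction has the form
  \<open>S x * v\<close>, so the derivative at 0 and \<open>S x\<close> determine the derivative at
  \<open>x\<close>.\<close>

lemma golab_schinzel_derivative:
  fixes S :: "'a::{banach, real_normed_algebra_1, comm_ring_1} \<Rightarrow> 'a"
  assumes cont: "continuous_on UNIV S" and zero: "0 \<in> G_star S"
    and diff: "\<And>x. S differentiable (at x)"
    and eq: "\<And>x y. x \<in> G_star S \<Longrightarrow> y \<in> G_star S \<Longrightarrow> S (x + S x * y) = S x * S y"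
    and x: "x \<in> G_star S"
  shows "frechet_derivative S (at x) (S x * v) = S x * frechet_derivative S (at 0) v"
proof -
  \<comment> \<open>The equation is available for \<open>y\<close> in \<open>G_star S\<close>;
    openness makes this a neighbourhood of 0, enough for the derivative.\<close>
  have op: "open (G_star S)"
    using open_vimage[OF open_alg_units cont] by (simp add: G_star_def vimage_def)
  have D: "(S has_derivative frechet_derivative S (at y)) (at y)" for y
    using diff frechet_derivative_works by blast
  have "((\<lambda>y. x + S x * y) has_derivative (\<lambda>v. S x * v)) (at 0)"
    by (auto intro!: derivative_eq_intros)
  then have "(S \<circ> (\<lambda>y. x + S x * y) has_derivative frechet_derivative S (at x) \<circ> (\<lambda>v. S x * v)) (at 0)"
    by (rule diff_chain_at) (simp add: D)
  then have "((\<lambda>y. S x * S y) has_derivative (\<lambda>v. frechet_derivative S (at x) (S x * v))) (at 0)"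
    by (auto simp: o_def eq x intro: has_derivative_transform_within_open[OF _ op zero])
  moreover have "((\<lambda>y. S x * S y) has_derivative (\<lambda>v. S x * frechet_derivative S (at 0) v)) (at 0)"
    by (intro has_derivative_mult_right D)
  ultimately show ?thesis by (rule has_derivative_unique[THEN fun_cong])
qed

text \<open>
  Uniqueness for the initial value problem of \<open>g t = S (u (e\<^bsup>tc\<^esup> - 1) / c) e\<^bsup>-tc\<^esup>\<close>: the functional
  equation gives \<open>g' = g L (u (g\<^sup>-\<^sup>1 - 1))\<close> with \<open>L = S' 0\<close>, so \<open>g'\<close> is bounded by a multiple of
  \<open>g - 1\<close> near \<open>0\<close>.
\<close>

lemma S_along_curve_near_0:
  fixes S :: "'a::{banach, real_normed_algebra_1, comm_ring_1} \<Rightarrow> 'a"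
  assumes cont: "continuous_on UNIV S" and zero: "0 \<in> G_star S"
    and diff: "\<And>x. S differentiable (at x)"
    and eq: "\<And>x y. x \<in> G_star S \<Longrightarrow> y \<in> G_star S \<Longrightarrow> S (x + S x * y) = S x * S y"
  obtains \<delta> where "\<delta> > 0"
    "\<And>t. 0 \<le> t \<Longrightarrow> t \<le> \<delta> \<Longrightarrow>
      S (u * entire_calc (exp_quot t) (gamma S u)) = exp (t *\<^sub>R gamma S u)"
proof -
  define c where "c = gamma S u"
  define L where "L = frechet_derivative S (at 0)"
  define D where "D = (\<lambda>x. frechet_derivative S (at x))"
  define x where "x = (\<lambda>t. u * entire_calc (exp_quot t) c)"
  define g where "g = (\<lambda>t. S (x t) * exp (t *\<^sub>R (- c)))"
  have SD: "(S has_derivative D y) (at y)" for y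
    using diff frechet_derivative_works unfolding D_def by blast
  have Lb: "bounded_linear L"
    unfolding L_def using SD D_def has_derivative_bounded_linear by blast
  then obtain K where K: "K > 0" "\<And>v. norm (L v) \<le> norm v * K"
    using bounded_linear.pos_bounded by blast
  have xD: "(x has_vector_derivative u * exp (t *\<^sub>R c)) (at t)" for t
    unfolding x_def by (intro has_vector_derivative_mult_right exp_quot_has_vector_derivative)
  have SxD: "((\<lambda>t. S (x t)) has_vector_derivative D (x t) (u * exp (t *\<^sub>R c))) (at t)" for t
    using vector_derivative_diff_chain_within[OF xD has_derivative_at_withinI[OF SD]]
    by (simp add: o_def)
  let ?g' = "\<lambda>t. D (x t) (u * exp (t *\<^sub>R c)) * exp (t *\<^sub>R (- c))
               + S (x t) * (exp (t *\<^sub>R (- c)) * (- c))"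
  have gD: "(g has_vector_derivative ?g' t) (at t)" for t
    unfolding g_def
    using has_vector_derivative_mult[OF SxD[of t] exp_scaleR_has_vector_derivative_right[of "-c" t UNIV]]
    by (simp add: add.commute)
  have g0: "g 0 = 1"
    using golab_schinzel_at_0[OF zero] eq by (simp add: g_def x_def exp_quot_at_0)
  have "isCont g 0" by (rule has_vector_derivative_continuous[OF gD])
  then obtain \<epsilon> :: real where \<epsilon>: "\<epsilon> > 0" "\<And>t. \<bar>t\<bar> < \<epsilon> \<Longrightarrow> norm (g t - 1) < 1 / 2"
    using g0 unfolding continuous_at_eps_delta dist_norm
    by (force dest: spec[of _ "1 / 2"])
  \<comment> \<open>The factors are \<open>3 / 2\<close> for \<open>g t\<close>, \<open>2\<close>
    for its inverse, \<open>K\<close> for \<open>L\<close>, and \<open>norm u\<close>; adding 1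
    keeps \<open>B\<close> positive when \<open>u = 0\<close>.\<close>
  define B where "B = 3 * K * norm u + 1"
  have B: "B > 0" using K by (auto simp: B_def intro!: add_nonneg_pos)
  have bound: "norm (?g' t) \<le> B * norm (g t - 1)" if t: "\<bar>t\<bar> < \<epsilon>" for t
  proof -
    have "norm (1 - g t) < 1" using \<epsilon>(2)[OF t] by (simp add: norm_minus_commute)
    then have "g t dvd 1" by (rule near_one_imp_unit)
    then have unit: "S (x t) dvd 1" by (simp add: g_def unit_mult_iff)
    then obtain j where j: "1 = S (x t) * j" by (rule dvdE)
    \<comment> \<open>\<open>h\<close> is the inverse of \<open>g t\<close>, so
      \<open>u * exp (t c) = S (x t) * (u * h)\<close> is a direction in which the derivative of
      \<open>S\<close> is known.\<close>
    define h where "h = j * exp (t *\<^sub>R c)"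
    have gh: "g t * h = 1"
      using j exp_minus_inverse[of "t *\<^sub>R c"] by (simp add: g_def h_def algebra_simps)
    have h1: "h - 1 = h * (1 - g t)" using gh by (simp add: algebra_simps)
    have "norm h \<le> 1 + norm (h - 1)" by (metis norm_one norm_triangle_sub)
    also have "\<dots> \<le> 1 + norm h * (1 / 2)"
      unfolding h1 using \<epsilon>(2)[OF t]
      by (intro add_left_mono order_trans[OF norm_mult_ineq] mult_left_mono)
         (auto simp: norm_minus_commute)
    finally have nh: "norm h \<le> 2" by simp
    have "norm (g t) \<le> 1 + norm (g t - 1)" by (metis norm_one norm_triangle_sub)
    then have ng: "norm (g t) \<le> 3 / 2" using \<epsilon>(2)[OF t] by linarith
    have "S (x t) * (u * h) = (S (x t) * j) * (u * exp (t *\<^sub>R c))" by (simp add: h_def mult_ac)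
    also have "\<dots> = u * exp (t *\<^sub>R c)" by (simp flip: j)
    finally have "u * exp (t *\<^sub>R c) = S (x t) * (u * h)" ..
    moreover have xt: "x t \<in> G_star S" using unit by (simp add: G_star_def alg_units_def)
    have "D (x t) (S (x t) * (u * h)) = S (x t) * L (u * h)"
      unfolding D_def L_def by (rule golab_schinzel_derivative[OF cont zero diff _ xt]) (rule eq)
    ultimately have "D (x t) (u * exp (t *\<^sub>R c)) = S (x t) * L (u * h)" by simp
    then have "?g' t = g t * (L (u * h) - L u)"
      by (simp add: g_def c_def gamma_def L_def algebra_simps)
    also have "\<dots> = g t * L (u * (h - 1))"
      using linear_diff[OF bounded_linear.linear[OF Lb], of "u * h" u]
      by (simp add: right_diff_distrib)
    finally have "norm (?g' t) \<le> norm (g t) * norm (L (u * (h - 1)))"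
      by (simp add: norm_mult_ineq)
    also have "\<dots> \<le> 3 / 2 * ((norm u * (2 * norm (g t - 1))) * K)"
    proof (intro mult_mono ng order_trans[OF K(2)] mult_right_mono)
      have "norm (h - 1) \<le> norm h * norm (1 - g t)" unfolding h1 by (rule norm_mult_ineq)
      also have "\<dots> \<le> 2 * norm (g t - 1)"
        using nh by (simp add: norm_minus_commute mult_right_mono)
      finally show "norm (u * (h - 1)) \<le> norm u * (2 * norm (g t - 1))"
        by (intro order_trans[OF norm_mult_ineq] mult_left_mono) auto
    qed (use K in auto)
    also have "\<dots> \<le> B * norm (g t - 1)" by (simp add: B_def algebra_simps)
    finally show ?thesis .
  qed
  \<comment> \<open>\<open>B * \<delta> \<le> 1 / 2\<close> turns the mean value estimate at a
    maximiser \<open>s\<close> of \<open>norm (g t - 1)\<close> into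
    \<open>norm (g s - 1) \<le> norm (g s - 1) / 2\<close>, so \<open>g\<close> is 1 on the
    interval.\<close>
  define \<delta> where "\<delta> = min (\<epsilon> / 2) (1 / (2 * B))"
  have \<delta>: "\<delta> > 0" "\<delta> < \<epsilon>" "B * \<delta> \<le> 1 / 2"
    using \<epsilon>(1) B by (auto simp: \<delta>_def min_def field_simps)
  let ?I = "{0..\<delta>}"
  have "continuous_on ?I (\<lambda>t. norm (g t - 1))"
    using gD has_vector_derivative_continuous
    by (intro continuous_intros continuous_at_imp_continuous_on) blast
  then obtain s where s: "s \<in> ?I" "\<And>t. t \<in> ?I \<Longrightarrow> norm (g t - 1) \<le> norm (g s - 1)"
    using continuous_attains_sup[of ?I "\<lambda>t. norm (g t - 1)"] \<delta>(1) by auto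
  have "norm (g s - g 0) \<le> (B * norm (g s - 1)) * norm (s - 0)"
  proof (rule differentiable_bound[of ?I g "\<lambda>t h. h *\<^sub>R ?g' t"])
    fix t assume t: "t \<in> ?I"
    show "(g has_derivative (\<lambda>h. h *\<^sub>R ?g' t)) (at t within ?I)"
      using gD[of t] has_derivative_at_withinI by (auto simp: has_vector_derivative_def)
    have "norm (?g' t) \<le> B * norm (g t - 1)" using bound t \<delta>(2) by auto
    also have "\<dots> \<le> B * norm (g s - 1)" using s(2)[OF t] B by simp
    finally have "norm (?g' t) \<le> B * norm (g s - 1)" .
    then show "onorm (\<lambda>h. h *\<^sub>R ?g' t) \<le> B * norm (g s - 1)"
      by (intro onorm_bound) (use B in \<open>auto simp: mult.commute mult_left_mono\<close>)
  qed (use s \<delta> in auto)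
  also have "\<dots> \<le> B * norm (g s - 1) * \<delta>"
    using s(1) B by (intro mult_left_mono) auto
  also have "\<dots> = (B * \<delta>) * norm (g s - 1)" by simp
  also have "\<dots> \<le> 1 / 2 * norm (g s - 1)" using \<delta>(3) by (rule mult_right_mono) simp
  finally have "norm (g s - 1) = 0" using g0 by simp
  then have "g t = 1" if "t \<in> ?I" for t using s(2)[OF that] by simp
  then have "S (x t) = exp (t *\<^sub>R c)" if "t \<in> ?I" for t
    using that exp_minus_inverse[of "t *\<^sub>R c"] unfolding g_def
    by (metis mult.commute mult.left_commute mult_1 scaleR_minus_right)
  then show thesis using that[OF \<delta>(1)] by (auto simp: x_def c_def)
qed

text \<open>\<open>t\<close> is cut into \<open>n\<close> equal steps of length at most
  \<open>\<delta>\<close>. As \<open>x (r + s) = x r + S (x r) * x s\<close> once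
  \<open>S (x r) = exp (r c)\<close>, the functional equation multiplies the known values.\<close>

lemma S_along_curve:
  fixes S :: "'a::{banach, real_normed_algebra_1, comm_ring_1} \<Rightarrow> 'a"
  assumes cont: "continuous_on UNIV S" and zero: "0 \<in> G_star S"
    and diff: "\<And>x. S differentiable (at x)"
    and eq: "\<And>x y. x \<in> G_star S \<Longrightarrow> y \<in> G_star S \<Longrightarrow> S (x + S x * y) = S x * S y"
    and t: "t \<ge> 0"
  shows "S (u * entire_calc (exp_quot t) (gamma S u)) = exp (t *\<^sub>R gamma S u)"
proof -
  define c where "c = gamma S u"
  define x where "x = (\<lambda>t. u * entire_calc (exp_quot t) c)"
  obtain \<delta> where \<delta>: "\<delta> > 0" "\<And>t. 0 \<le> t \<Longrightarrow> t \<le> \<delta> \<Longrightarrow> S (x t) = exp (t *\<^sub>R c)"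
    unfolding x_def c_def
    by (rule S_along_curve_near_0[OF cont zero diff, of u]) (rule eq, assumption+, blast)
  have multiple: "S (x (of_nat k * s)) = exp ((of_nat k * s) *\<^sub>R c)" if "0 \<le> s" "s \<le> \<delta>" for k s
  proof (induction k)
    case 0
    then show ?case using golab_schinzel_at_0[OF zero] eq by (simp add: x_def exp_quot_at_0)
  next
    case (Suc k)
    have *: "of_nat (Suc k) * s = of_nat k * s + s" by (simp add: algebra_simps)
    have "x (of_nat (Suc k) * s) = x (of_nat k * s) + S (x (of_nat k * s)) * x s"
      unfolding * Suc unfolding x_def exp_quot_add by (simp add: distrib_left mult.left_commute)
    moreover have "x (of_nat k * s) \<in> G_star S" "x s \<in> G_star S"
      using Suc \<delta>(2)[OF that] exp_unit by (auto simp: G_star_def alg_units_def)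
    ultimately show ?case using Suc \<delta>(2)[OF that] eq * exp_scaleR_add by metis
  qed
  obtain n :: nat where n: "n > 0" "t < of_nat n * \<delta>"
    using reals_Archimedean3[OF \<delta>(1), THEN spec, of t] t
    by (metis gr0I mult_zero_left not_less of_nat_0)
  then have "t / of_nat n \<le> \<delta>" by (simp add: field_simps)
  then have "S (x (of_nat n * (t / of_nat n))) = exp ((of_nat n * (t / of_nat n)) *\<^sub>R c)"
    using multiple t by (intro multiple) auto
  then show ?thesis using n by (simp add: x_def c_def)
qed

subsection \<open>Continuous exponential cocycles\<close>

text \<open>Additivity propagates the zero at 1 to all nonnegative rationals, and continuity to all
  \<open>t\<close>.\<close>

lemma continuous_additive_eq_0:
  fixes D :: "real \<Rightarrow> 'a::real_normed_vector"
  assumes cont: "continuous_on {0..} D"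
    and add: "\<And>s t. s \<ge> 0 \<Longrightarrow> t \<ge> 0 \<Longrightarrow> D (s + t) = D s + D t"
    and one: "D 1 = 0" and t: "t \<ge> 0"
  shows "D t = 0"
proof -
  have mult: "D (of_nat k * s) = of_nat k *\<^sub>R D s" if "s \<ge> 0" for k s
  proof (induction k)
    case 0
    then show ?case using add[of 0 0] by simp
  next
    case (Suc k)
    then show ?case using add[of "of_nat k * s" s] that by (simp add: algebra_simps)
  qed
  have q: "D (of_nat k / of_nat m) = 0" if "m > 0" for k m :: nat
    using mult[of "1 / of_nat m" m] mult[of "1 / of_nat m" k] that one by simp
  define r where "r = (\<lambda>m. of_nat (nat \<lfloor>t * of_nat (Suc m)\<rfloor>) / of_nat (Suc m) :: real)"
  have r: "t - 1 / of_nat (Suc m) \<le> r m" "r m \<le> t" "r m \<ge> 0" for m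
  proof -
    have "t * of_nat (Suc m) \<ge> 0" using t by simp
    then have "t * of_nat (Suc m) - 1 \<le> of_nat (nat \<lfloor>t * of_nat (Suc m)\<rfloor>)"
      "of_nat (nat \<lfloor>t * of_nat (Suc m)\<rfloor>) \<le> t * of_nat (Suc m)"
      by linarith+
    then show "t - 1 / of_nat (Suc m) \<le> r m" "r m \<le> t" "r m \<ge> 0"
      by (simp_all add: r_def divide_le_eq le_divide_eq left_diff_distrib del: of_nat_Suc)
  qed
  have "(\<lambda>m. t - 1 / of_nat (Suc m)) \<longlonglongrightarrow> t - 0"
    by (intro tendsto_diff tendsto_const lim_1_over_n[THEN LIMSEQ_Suc])
  then have "(\<lambda>m. t - 1 / of_nat (Suc m)) \<longlonglongrightarrow> t" by simp
  then have "r \<longlonglongrightarrow> t"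
    using r by (intro tendsto_sandwich[OF _ _ _ tendsto_const, of _ r]) auto
  then have "(\<lambda>m. D (r m)) \<longlonglongrightarrow> D t"
    using cont t r(3) by (auto simp: continuous_on_sequentially o_def)
  moreover have "(\<lambda>m. D (r m)) = (\<lambda>_. 0)" using q by (auto simp: r_def simp del: of_nat_Suc)
  ultimately show ?thesis by (simp add: LIMSEQ_const_iff)
qed

text \<open>
  The difference \<open>D\<close> of the two sides is again a cocycle for \<open>t \<mapsto> e\<^bsup>tc\<^esup>\<close>, and symmetry in \<open>s, t\<close>
  of \<open>n (s + t)\<close> yields \<open>c D = 0\<close>; hence \<open>D\<close> is additive, even when \<open>c\<close> is a zero divisor.
\<close>

lemma exp_cocycle_proportional:
  fixes n :: "real \<Rightarrow> 'a::{banach, real_normed_algebra_1, comm_ring_1}"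
  assumes cont: "continuous_on {0..} n"
    and cocycle: "\<And>s t. s \<ge> 0 \<Longrightarrow> t \<ge> 0 \<Longrightarrow> n (s + t) = n s + exp (s *\<^sub>R c) * n t"
    and t: "t \<ge> 0"
  shows "entire_calc (exp_quot 1) c * n t = entire_calc (exp_quot t) c * n 1"
proof -
  let ?\<phi> = "\<lambda>t. entire_calc (exp_quot t) c"
  define D where "D = (\<lambda>t. ?\<phi> 1 * n t - ?\<phi> t * n 1)"
  have cD: "c * D t = 0" if "t \<ge> 0" for t
  proof -
    \<comment> \<open>Both sides are \<open>n (1 + t)\<close>.\<close>
    have "n 1 + exp (1 *\<^sub>R c) * n t = n t + exp (t *\<^sub>R c) * n 1"
      using cocycle[of 1 t] cocycle[of t 1] that by (simp add: add.commute)
    then have "(exp (1 *\<^sub>R c) - 1) * n t = (exp (t *\<^sub>R c) - 1) * n 1" by (simp add: algebra_simps)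
    then show ?thesis by (simp add: D_def exp_quot_times_arg[symmetric] algebra_simps del: scaleR_one)
  qed
  have "D (s + t) = D s + D t" if "s \<ge> 0" "t \<ge> 0" for s t
  proof -
    have "D (s + t) = D s + exp (s *\<^sub>R c) * D t"
      using that by (simp add: D_def cocycle exp_quot_add algebra_simps)
    \<comment> \<open>\<open>exp (s c) - 1 = c \<phi> s\<close> annihilates \<open>D t\<close>, so
      the factor \<open>exp (s c)\<close> acts on it as 1.\<close>
    moreover have "(exp (s *\<^sub>R c) - 1) * D t = 0"
      using cD[OF that(2)] by (simp flip: exp_quot_times_arg add: mult.commute[of c] mult.assoc)
    ultimately show ?thesis by (simp add: algebra_simps)
  qed
  moreover have "continuous_on {0..} D"
    unfolding D_def using exp_quot_has_vector_derivative[of c] has_vector_derivative_continuous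
    by (intro continuous_intros cont continuous_at_imp_continuous_on) blast
  moreover have "D 1 = 0" by (simp add: D_def)
  ultimately have "D t = 0" using continuous_additive_eq_0 t by blast
  then show ?thesis by (simp add: D_def)
qed

subsection \<open>Invertibility of \<open>\<mu> c\<close>\<close>

lemma of_real_unit:
  "r \<noteq> 0 \<Longrightarrow> (of_real r :: 'a::{real_normed_algebra_1, comm_ring_1}) dvd 1"
  by (rule dvdI[of _ _ "of_real (1 / r)"]) (simp flip: of_real_mult)

lemma cosh_series_square:
  fixes b :: "'a::{banach, real_normed_algebra_1, comm_ring_1}"
  shows "(\<lambda>n. (b\<^sup>2) ^ n /\<^sub>R fact (2 * n)) sums cosh b"
proof -
  have "(\<lambda>n. if even (2 * n) then b ^ (2 * n) /\<^sub>R fact (2 * n) else 0) sums cosh b"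
    by (subst sums_mono_reindex[of "\<lambda>n. 2 * n" "\<lambda>n. if even n then b ^ n /\<^sub>R fact n else 0"])
       (auto simp: strict_mono_def cosh_converges elim!: evenE)
  then show ?thesis by (simp add: power_mult)
qed

text \<open>The series of \<open>cosh_series_square\<close> with \<open>b^2\<close> replaced by
  \<open>- \<theta>^2\<close>, a substitute for \<open>cos \<theta> = cosh (i \<theta>)\<close> in
  the real algebra.\<close>

lemma cos_series_square:
  "(\<lambda>n. (of_real (- (\<theta>\<^sup>2))) ^ n /\<^sub>R fact (2 * n)) sums
     (of_real (cos \<theta>) :: 'a::{banach, real_normed_algebra_1, comm_ring_1})"
proof -
  have "(of_real (- (\<theta>\<^sup>2))) ^ n /\<^sub>R fact (2 * n)
      = (of_real ((- 1) ^ n / fact (2 * n) * \<theta> ^ (2 * n)) :: 'a)" for n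
  proof -
    have "(- (\<theta>\<^sup>2)) ^ n = (- 1) ^ n * \<theta> ^ (2 * n)"
      by (metis mult_minus1 power_mult power_mult_distrib)
    then show ?thesis
      by (simp add: scaleR_conv_of_real divide_inverse mult_ac flip: of_real_mult of_real_power of_real_minus)
  qed
  then show ?thesis using sums_of_real[OF cos_paired[of \<theta>], where 'a = 'a] by simp
qed

text \<open>Supplies a geometric majorant for the cofactor series in
  \<open>cosh_minus_cos_factor\<close>.\<close>

lemma fact_lower_bound: "6 * 3 ^ n \<le> (fact (2 * n + 3) :: real)"
proof (induction n)
  case 0
  then show ?case by (simp add: fact_numeral)
next
  case (Suc n)
  have "(6 * 3 ^ Suc n :: real) \<le> 3 * fact (2 * n + 3)" using Suc by simp
  also have "\<dots> \<le> (real (2 * n + 5) * real (2 * n + 4)) * fact (2 * n + 3)"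
  proof (rule mult_right_mono)
    have "(3::real) \<le> 5 * 4" by simp
    also have "\<dots> \<le> real (2 * n + 5) * real (2 * n + 4)" by (intro mult_mono) auto
    finally show "3 \<le> real (2 * n + 5) * real (2 * n + 4)" .
  qed simp
  also have "\<dots> = fact (2 * Suc n + 3)"
    by (simp add: numeral_eq_Suc algebra_simps)
  finally show ?case .
qed

text \<open>Both functions are one power series, at \<open>X = b^2\<close> and at
  \<open>Y = - \<theta>^2\<close>, so \<open>X - Y\<close> divides the difference term by term. The
  cofactor \<open>G\<close> starts with \<open>1 / 2\<close> and its remaining terms are small,
  which makes it a unit.\<close>

lemma cosh_minus_cos_factor:
  fixes b :: "'a::{banach, real_normed_algebra_1, comm_ring_1}"
  assumes b: "norm b \<le> 1" and \<theta>: "\<bar>\<theta>\<bar> \<le> 1"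
  obtains G where "cosh b - of_real (cos \<theta>) = (b\<^sup>2 + of_real (\<theta>\<^sup>2)) * G"
    and "norm (2 *\<^sub>R G - 1) \<le> 1 / 4"
proof -
  define X where "X = b\<^sup>2"
  define Y where "Y = (of_real (- (\<theta>\<^sup>2)) :: 'a)"
  define q where "q = (\<lambda>n. \<Sum>p<Suc n. X ^ p * Y ^ (n - p))"
  have X: "norm X \<le> 1"
    unfolding X_def using b norm_power_ineq[of b 2] power_mono[of "norm b" 1 2] by simp
  have Y: "norm Y \<le> 1"
    unfolding Y_def norm_of_real using \<theta> power_mono[of "\<bar>\<theta>\<bar>" 1 2] by simp
  have nq: "norm (q n) \<le> real (Suc n)" for n
  proof -
    have "norm (X ^ p * Y ^ m) \<le> 1" for p m
    proof -
      have "norm (X ^ p * Y ^ m) \<le> norm X ^ p * norm Y ^ m"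
        by (intro order_trans[OF norm_mult_ineq] mult_mono norm_power_ineq) auto
      also have "\<dots> \<le> 1 * 1"
        using X Y by (intro mult_mono power_le_one) auto
      finally show ?thesis by simp
    qed
    then have "norm (q n) \<le> (\<Sum>p<Suc n. 1)" unfolding q_def by (intro sum_norm_le) simp
    then show ?thesis by simp
  qed
  \<comment> \<open>The constant terms cancel in the difference, so \<open>f n\<close> belongs to
    the exponent \<open>n + 1\<close>: \<open>q n\<close> is the cofactor of \<open>X - Y\<close> in
    \<open>X^(n+1) - Y^(n+1)\<close>.\<close>
  define f where "f = (\<lambda>n. q n /\<^sub>R fact (2 * Suc n))"
  have bound: "norm (2 *\<^sub>R f (Suc n)) \<le> (1 / 6) * (1 / 3) ^ n" for n
  proof -
    have "norm (2 *\<^sub>R f (Suc n)) = 2 * (norm (q (Suc n)) / fact (2 * Suc (Suc n)))"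
      by (simp add: f_def divide_inverse del: fact_Suc mult_Suc_right)
    also have "\<dots> \<le> 2 * (real (Suc (Suc n)) / fact (2 * Suc (Suc n)))"
      using nq[of "Suc n"] by (intro mult_left_mono divide_right_mono) auto
    also have "\<dots> = 1 / fact (2 * n + 3)"
    proof -
      have "(fact (2 * Suc (Suc n)) :: real) = (2 * real (Suc (Suc n))) * fact (2 * n + 3)"
        by (simp add: numeral_eq_Suc algebra_simps)
      then show ?thesis by (simp del: fact_Suc of_nat_Suc)
    qed
    also have "\<dots> \<le> 1 / (6 * 3 ^ n)"
      using fact_lower_bound[of n] by (intro divide_left_mono) auto
    also have "\<dots> = (1 / 6) * (1 / 3) ^ n" by (simp add: power_divide)
    finally show ?thesis .
  qed
  have sg: "summable (\<lambda>n. (1 / 6) * (1 / 3 :: real) ^ n)"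
    by (intro summable_mult summable_geometric) simp
  have s2: "summable (\<lambda>n. 2 *\<^sub>R f (Suc n))"
    by (rule summable_comparison_test[OF _ sg]) (use bound in blast)
  then have "summable (\<lambda>n. f (Suc n))"
    using summable_scaleR_right[OF s2, of "1 / 2"] by simp
  then have sf: "summable f" by (simp add: summable_Suc_iff)
  let ?G = "\<Sum>n. f n"
  have "f 0 = (1 / 2) *\<^sub>R 1" by (simp add: f_def q_def)
  then have "?G = (1 / 2) *\<^sub>R 1 + (\<Sum>n. f (Suc n))"
    using suminf_split_head[OF sf] by (simp add: algebra_simps)
  then have "2 *\<^sub>R ?G = 1 + 2 *\<^sub>R (\<Sum>n. f (Suc n))"
    by (simp only: scaleR_right_distrib) simp
  then have "2 *\<^sub>R ?G - 1 = (\<Sum>n. 2 *\<^sub>R f (Suc n))"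
    using suminf_scaleR_right[OF \<open>summable (\<lambda>n. f (Suc n))\<close>, of 2] by simp
  then have "norm (2 *\<^sub>R ?G - 1) \<le> (\<Sum>n. (1 / 6) * (1 / 3 :: real) ^ n)"
    using norm_suminf_le[OF bound sg] by simp
  also have "\<dots> = (1 / 6) * (1 / (1 - 1 / 3))"
    by (rule sums_unique[symmetric], intro sums_mult geometric_sums) simp
  finally have 1: "norm (2 *\<^sub>R ?G - 1) \<le> 1 / 4" by simp
  have "(\<lambda>n. X ^ n /\<^sub>R fact (2 * n) - Y ^ n /\<^sub>R fact (2 * n)) sums (cosh b - of_real (cos \<theta>))"
    unfolding X_def Y_def by (intro sums_diff cosh_series_square cos_series_square)
  then have "(\<lambda>n. X ^ Suc n /\<^sub>R fact (2 * Suc n) - Y ^ Suc n /\<^sub>R fact (2 * Suc n))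
      sums (cosh b - of_real (cos \<theta>))"
    by (subst sums_Suc_iff) simp
  also have "(\<lambda>n. X ^ Suc n /\<^sub>R fact (2 * Suc n) - Y ^ Suc n /\<^sub>R fact (2 * Suc n))
      = (\<lambda>n. (X - Y) * f n)"
    unfolding f_def q_def mult_scaleR_right diff_power_eq_sum[symmetric]
    by (simp add: scaleR_right_diff_distrib)
  finally have "cosh b - of_real (cos \<theta>) = (X - Y) * ?G"
    using sums_mult[OF summable_sums[OF sf], of "X - Y"] sums_unique2 by blast
  also have "X - Y = b\<^sup>2 + of_real (\<theta>\<^sup>2)" by (simp add: X_def Y_def)
  finally show thesis using 1 by (rule that)
qed

lemma cosh_double_algebra:
  fixes b :: "'a::{banach, real_normed_algebra_1, comm_ring_1}"
  shows "cosh (2 *\<^sub>R b) = 2 * (cosh b)\<^sup>2 - 1"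
proof -
  have e: "exp (2 *\<^sub>R a) = (exp a)\<^sup>2" for a :: 'a
    using exp_scaleR_add[of 1 1 a] by (simp add: power2_eq_square)
  have "(exp b + exp (- b))\<^sup>2 = exp (2 *\<^sub>R b) + exp (- (2 *\<^sub>R b)) + 2"
    using e[of b] e[of "- b"] exp_minus_inverse[of b] by (simp add: power2_sum mult.assoc)
  then have "(cosh b)\<^sup>2 = (1 / 4) *\<^sub>R (exp (2 *\<^sub>R b) + exp (- (2 *\<^sub>R b)) + 2 *\<^sub>R 1)"
    by (simp add: cosh_def scaleR_power power_divide scaleR_2)
  then have "2 *\<^sub>R (cosh b)\<^sup>2 = cosh (2 *\<^sub>R b) + 1"
    by (simp add: cosh_def scaleR_right_distrib)
  then show ?thesis by (simp add: scaleR_2)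
qed

text \<open>As \<open>cos (\<theta> + pi) = - cos \<theta>\<close>, the product is a difference of
  squares. Its two factors share out the zeros by parity of the multiple of
  \<open>pi\<close>.\<close>

lemma cosh_minus_cos_double:
  fixes b :: "'a::{banach, real_normed_algebra_1, comm_ring_1}"
  shows "cosh (2 *\<^sub>R b) - of_real (cos (2 * \<theta>))
    = 2 * ((cosh b - of_real (cos \<theta>)) * (cosh b - of_real (cos (\<theta> + pi))))"
  unfolding cosh_double_algebra cos_double_cos
  by (simp add: power2_eq_square algebra_simps)

text \<open>Modulo \<open>2 pi\<close> the angle lies in \<open>[-pi, pi]\<close>. If it is at most
  1 in absolute value, the factorisation has a unit cofactor; otherwise \<open>cosh b\<close> is
  near 1 while \<open>cos \<theta> \<le> cos 1\<close>, and the difference is close to the positive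
  number \<open>1 - cos \<theta>\<close>.\<close>

lemma cosh_minus_cos_unit_small:
  obtains \<epsilon> :: real where "\<epsilon> > 0"
    "\<And>(b :: 'a::{banach, real_normed_algebra_1, comm_ring_1}) \<theta>.
       norm b < \<epsilon> \<Longrightarrow> (\<And>k::int. b\<^sup>2 + of_real ((\<theta> + 2 * pi * of_int k)\<^sup>2) dvd 1) \<Longrightarrow>
       cosh b - of_real (cos \<theta>) dvd 1"
proof -
  define \<eta> where "\<eta> = 1 - cos (1::real)"
  have \<eta>: "\<eta> > 0" using cos_monotone_0_pi[of 0 1] pi_gt3 by (simp add: \<eta>_def)
  have "cosh b - of_real (cos \<theta>) dvd 1"
    if b: "norm b < min 1 \<eta>" and units: "\<And>k::int. b\<^sup>2 + of_real ((\<theta> + 2 * pi * of_int k)\<^sup>2) dvd 1"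
    for b :: 'a and \<theta>
  proof -
    define k where "k = - \<lfloor>(\<theta> + pi) / (2 * pi)\<rfloor>"
    define \<theta>' where "\<theta>' = \<theta> + 2 * pi * of_int k"
    have cos: "cos \<theta>' = cos \<theta>"
      by (simp add: \<theta>'_def cos_add cos_int_2pin sin_int_2pin)
    have "of_int (- k) \<le> (\<theta> + pi) / (2 * pi)" "(\<theta> + pi) / (2 * pi) < of_int (- k) + 1"
      unfolding k_def by linarith+
    then have \<theta>': "\<bar>\<theta>'\<bar> \<le> pi"
      by (simp add: \<theta>'_def field_simps abs_le_iff)
    show ?thesis
    proof (cases "\<bar>\<theta>'\<bar> \<le> 1")
      case True
      obtain G where G: "cosh b - of_real (cos \<theta>') = (b\<^sup>2 + of_real (\<theta>'\<^sup>2)) * G"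
        and "norm (2 *\<^sub>R G - 1) \<le> 1 / 4"
        using cosh_minus_cos_factor[OF _ True, of b] b by auto
      then have "2 *\<^sub>R G dvd 1" by (intro near_one_imp_unit) (simp add: norm_minus_commute)
      then have "G dvd 1" by (simp add: scaleR_conv_of_real unit_mult_iff)
      then show ?thesis using G cos units[of k] by (simp add: \<theta>'_def unit_mult_iff)
    next
      case False
      \<comment> \<open>The factorisation at angle 0 serves to bound \<open>cosh b - 1\<close> by
        \<open>norm b\<close>.\<close>
      obtain G where G: "cosh b - of_real (cos 0) = (b\<^sup>2 + of_real (0\<^sup>2)) * G"
        and G1: "norm (2 *\<^sub>R G - 1) \<le> 1 / 4"
        using cosh_minus_cos_factor[of b 0] b by auto
      have "norm (2 *\<^sub>R G) \<le> 1 + norm (2 *\<^sub>R G - 1)" by (metis norm_one norm_triangle_sub)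
      then have nG: "norm G \<le> 1" using G1 by simp
      have "norm (cosh b - 1) \<le> norm (b\<^sup>2) * norm G"
        using G norm_mult_ineq[of "b\<^sup>2" G] by simp
      also have "\<dots> \<le> norm (b\<^sup>2) * 1" using nG by (intro mult_left_mono) auto
      also have "\<dots> \<le> norm b * norm b" by (simp add: power2_eq_square norm_mult_ineq)
      also have "\<dots> \<le> norm b * 1" using b by (intro mult_left_mono) auto
      finally have small: "norm (cosh b - 1) < \<eta>" using b by simp
      define d where "d = 1 - cos \<theta>"
      have "cos \<bar>\<theta>'\<bar> \<le> cos 1" using False \<theta>' by (intro cos_monotone_0_pi_le) auto
      then have d: "d \<ge> \<eta>" using cos by (simp add: d_def \<eta>_def)
      define w where "w = (1 / d) *\<^sub>R (cosh b - of_real (cos \<theta>))"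
      have "cosh b - of_real (cos \<theta>) = (cosh b - 1) + d *\<^sub>R 1" by (simp add: d_def of_real_def algebra_simps)
      then have "w = (1 / d) *\<^sub>R ((cosh b - 1) + d *\<^sub>R 1)" by (simp only: w_def)
      then have "w - 1 = (1 / d) *\<^sub>R (cosh b - 1)"
        using d \<eta> by (simp only: scaleR_right_distrib) simp
      then have "norm (w - 1) = norm (cosh b - 1) / d" using d \<eta> by simp
      also have "\<dots> < 1" using small d \<eta> by (simp add: divide_less_eq)
      finally have "w dvd 1" by (intro near_one_imp_unit) (simp add: norm_minus_commute)
      then show ?thesis by (simp add: w_def scaleR_conv_of_real unit_mult_iff)
    qed
  qed
  then show thesis using that[of "min 1 \<eta>"] \<eta> by simp
qed

text \<open>
  The zeros of \<open>z \<mapsto> cosh z - cos \<theta>\<close> are the points \<open>\<plusminus> i (\<theta> + 2 \<pi> k)\<close>. The duplication formula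
  reduces this instance of the spectral mapping theorem to elements of small norm, where only the
  zeros closest to \<open>0\<close> matter.
\<close>

lemma cosh_minus_cos_unit:
  fixes b :: "'a::{banach, real_normed_algebra_1, comm_ring_1}"
  assumes "\<And>k::int. b\<^sup>2 + of_real ((\<theta> + 2 * pi * of_int k)\<^sup>2) dvd 1"
  shows "cosh b - of_real (cos \<theta>) dvd 1"
proof -
  obtain \<epsilon> :: real where \<epsilon>: "\<epsilon> > 0" and small:
    "\<And>(b :: 'a) \<theta>. norm b < \<epsilon> \<Longrightarrow> (\<And>k::int. b\<^sup>2 + of_real ((\<theta> + 2 * pi * of_int k)\<^sup>2) dvd 1)
        \<Longrightarrow> cosh b - of_real (cos \<theta>) dvd 1"
    using cosh_minus_cos_unit_small by blast
  have "cosh b - of_real (cos \<theta>) dvd 1"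
    if "norm b < 2 ^ n * \<epsilon>" "\<And>k::int. b\<^sup>2 + of_real ((\<theta> + 2 * pi * of_int k)\<^sup>2) dvd 1"
    for n and b :: 'a and \<theta>
    using that
  proof (induction n arbitrary: b \<theta>)
    case 0
    then show ?case using small by simp
  next
    case (Suc n)
    let ?b = "(1 / 2) *\<^sub>R b"
    have half: "?b\<^sup>2 + of_real (r\<^sup>2) = of_real (1 / 4) * (b\<^sup>2 + of_real ((2 * r)\<^sup>2))" for r
      by (simp add: scaleR_conv_of_real power2_eq_square algebra_simps flip: of_real_mult)
    \<comment> \<open>The angles \<open>\<theta> / 2\<close> and \<open>\<theta> / 2 + pi\<close>
      use the even and the odd indices of the hypothesis on \<open>b\<close>.\<close>
    have hunit: "?b\<^sup>2 + of_real (r\<^sup>2) dvd 1" if "2 * r = \<theta> + 2 * pi * of_int k" for r k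
      unfolding half that using Suc.prems(2)[of k]
      by (auto simp only: unit_mult_iff intro!: of_real_unit)
    have "norm ?b < 2 ^ n * \<epsilon>" using Suc.prems(1) by simp
    note IH = Suc.IH[OF this]
    have "cosh ?b - of_real (cos (\<theta> / 2)) dvd 1"
      by (rule IH, rule_tac k = "2 * k" in hunit) (simp add: algebra_simps)
    moreover have "cosh ?b - of_real (cos (\<theta> / 2 + pi)) dvd 1"
      by (rule IH, rule_tac k = "2 * k + 1" in hunit) (simp add: algebra_simps)
    moreover have "(2::'a) dvd 1" using of_real_unit[of 2, where 'a = 'a] by simp
    ultimately show ?case
      using cosh_minus_cos_double[of ?b "\<theta> / 2"] by (simp add: unit_mult_iff)
  qed
  moreover obtain n where "norm b / \<epsilon> < 2 ^ n" using real_arch_pow[of 2] by auto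
  then have "norm b < 2 ^ n * \<epsilon>" using \<epsilon> by (simp add: field_simps)
  ultimately show ?thesis using assms by blast
qed

text \<open>\<open>(exp a + 1)^2 exp (- a) = 2 (cosh a - cos pi)\<close>, so
  \<open>exp a + 1\<close> divides a unit.\<close>

lemma exp_plus_one_unit:
  fixes a :: "'a::{banach, real_normed_algebra_1, comm_ring_1}"
  assumes "\<And>k::int. a\<^sup>2 + of_real ((pi + 2 * pi * of_int k)\<^sup>2) dvd 1"
  shows "exp a + 1 dvd 1"
proof -
  have "(exp a + 1) * ((exp a + 1) * exp (- a)) = (exp a * exp (- a)) * (exp a + 1) + exp (- a) * exp a + exp (- a)"
    by (simp add: algebra_simps)
  also have "\<dots> = 2 *\<^sub>R (cosh a - of_real (cos pi))"
    using exp_minus_inverse[of a] by (simp add: cosh_def mult.commute algebra_simps scaleR_2)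
  finally show ?thesis
    using cosh_minus_cos_unit[OF assms] of_real_unit[of 2, where 'a = 'a]
    by (metis scaleR_conv_of_real unit_mult_iff zero_neq_numeral)
qed

text \<open>The constant term of the series is 1 and the rest has norm at most
  \<open>1 / 2\<close>.\<close>

lemma mu_unit_small:
  fixes c :: "'a::{banach, real_normed_algebra_1, comm_ring_1}"
  assumes c: "norm c \<le> 1 / 2"
  shows "entire_calc (exp_quot 1) c dvd 1"
proof (rule near_one_imp_unit)
  let ?f = "\<lambda>n. (1 ^ Suc n / fact (Suc n)) *\<^sub>R c ^ n"
  have bound: "norm (?f (Suc n)) \<le> (1 / 4) * (1 / 2) ^ n" for n
  proof -
    have "norm (?f (Suc n)) = (1 / fact (Suc (Suc n))) * norm (c ^ Suc n)" by (simp del: fact_Suc)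
    also have "\<dots> \<le> (1 / fact 2) * (1 / 2) ^ Suc n"
    proof (intro mult_mono divide_left_mono)
      show "(fact 2 :: real) \<le> fact (Suc (Suc n))" by (intro fact_mono) simp
      show "norm (c ^ Suc n) \<le> (1 / 2) ^ Suc n"
        by (intro order_trans[OF norm_power_ineq] power_mono c) simp
    qed auto
    finally show ?thesis by (simp add: fact_numeral)
  qed
  have sg: "summable (\<lambda>n. (1 / 4) * (1 / 2 :: real) ^ n)"
    by (intro summable_mult summable_geometric) simp
  have "(\<lambda>n. ?f (Suc n)) sums (entire_calc (exp_quot 1) c - 1)"
    by (subst sums_Suc_iff) (simp add: exp_quot_series_sums[of 1, simplified])
  then have "norm (entire_calc (exp_quot 1) c - 1) \<le> (\<Sum>n. (1 / 4) * (1 / 2 :: real) ^ n)"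
    using norm_suminf_le[OF bound sg] by (simp only: sums_iff)
  also have "\<dots> = (1 / 4) * (1 / (1 - 1 / 2))"
    by (rule sums_unique[symmetric], intro sums_mult geometric_sums) simp
  finally show "norm (1 - entire_calc (exp_quot 1) c) < 1" by (simp add: norm_minus_commute)
qed

text \<open>The duplication formula \<open>2 mu (2 a) = mu a (exp a + 1)\<close> reduces the claim
  to \<open>c / 2^n\<close>, of norm at most \<open>1 / 2\<close>, provided that each factor
  \<open>exp a + 1\<close> is a unit.\<close>

lemma mu_unit:
  fixes c :: "'a::{banach, real_normed_algebra_1, comm_ring_1}"
  assumes "\<And>k::int. k \<noteq> 0 \<Longrightarrow> c\<^sup>2 + of_real ((2 * pi * of_int k)\<^sup>2) dvd 1"
  shows "entire_calc (exp_quot 1) c dvd 1"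
proof -
  let ?\<phi> = "\<lambda>c. entire_calc (exp_quot 1) c"
  have double: "2 * ?\<phi> (2 *\<^sub>R a) = ?\<phi> a * (exp a + 1)" for a :: 'a
    using scale_exp_quot[of 2 a] exp_quot_add[of 1 1 a]
    by (simp add: scaleR_conv_of_real algebra_simps)
  have step: "?\<phi> c dvd 1"
    if "?\<phi> ((1 / 2 ^ n) *\<^sub>R c) dvd 1"
      "\<And>k::int. k \<noteq> 0 \<Longrightarrow> c\<^sup>2 + of_real ((2 * pi * of_int k)\<^sup>2) dvd 1" for n and c :: 'a
    using that
  proof (induction n arbitrary: c)
    case 0
    then show ?case by simp
  next
    case (Suc n)
    let ?a = "(1 / 2) *\<^sub>R c"
    have half: "?a\<^sup>2 + of_real (r\<^sup>2) = of_real (1 / 4) * (c\<^sup>2 + of_real ((2 * r)\<^sup>2))" for r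
      by (simp add: scaleR_conv_of_real power2_eq_square algebra_simps flip: of_real_mult)
    have hunit: "?a\<^sup>2 + of_real (r\<^sup>2) dvd 1" if "2 * r = 2 * pi * of_int k" "k \<noteq> 0" for r k
      unfolding half that using Suc.prems(2)[OF that(2)]
      by (auto simp only: unit_mult_iff intro!: of_real_unit)
    have "?\<phi> ?a dvd 1"
    proof (rule Suc.IH)
      show "?\<phi> ((1 / 2 ^ n) *\<^sub>R ?a) dvd 1" using Suc.prems(1) by (simp add: mult.commute)
      show "?a\<^sup>2 + of_real ((2 * pi * of_int k)\<^sup>2) dvd 1" if "k \<noteq> 0" for k
        by (rule hunit[of _ "2 * k"]) (use that in auto)
    qed
    moreover have "exp ?a + 1 dvd 1"
    proof (rule exp_plus_one_unit)
      fix k :: int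
      \<comment> \<open>The zeros of \<open>exp a + 1\<close> correspond to odd indices for
        \<open>c = 2 a\<close>, so the excluded index 0 does not occur.\<close>
      have "1 + 2 * k \<noteq> 0" by presburger
      then show "?a\<^sup>2 + of_real ((pi + 2 * pi * of_int k)\<^sup>2) dvd 1"
        by (intro hunit[of _ "1 + 2 * k"]) (simp_all add: algebra_simps)
    qed
    ultimately have "2 * ?\<phi> (2 *\<^sub>R ?a) dvd 1" unfolding double by (simp add: unit_mult_iff)
    then show ?case by (simp add: unit_mult_iff)
  qed
  obtain n where "2 * norm c < 2 ^ n" using real_arch_pow[of 2] by auto
  then have "?\<phi> ((1 / 2 ^ n) *\<^sub>R c) dvd 1" by (intro mu_unit_small) (simp add: field_simps)
  then show ?thesis using step assms by blast
qed

subsection \<open>The exponential tilting map\<close>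

text \<open>\<open>c^2 + \<theta>^2\<close> is the product of \<open>c - i \<theta>\<close> with its
  conjugate; if \<open>p + i q\<close> inverts \<open>c - i \<theta>\<close>, then
  \<open>p^2 + q^2\<close> inverts this product. Spectral conditions thus move into the real
  algebra.\<close>

lemma not_in_spec_imp_unit:
  fixes c :: "'a::{banach, real_normed_algebra_1, comm_ring_1}"
  assumes "Complex 0 \<theta> \<notin> spec c"
  shows "c\<^sup>2 + of_real (\<theta>\<^sup>2) dvd 1"
proof -
  obtain p q where q: "cx_mult (c, - of_real \<theta>) (p, q) = (1, 0)"
    using assms by (auto simp: spec_def cx_invertible_def)
  then have q: "c * p + of_real \<theta> * q = 1" "c * q = of_real \<theta> * p"
    by (auto simp: cx_mult_def algebra_simps)
  have "(c\<^sup>2 + of_real (\<theta>\<^sup>2)) * (p\<^sup>2 + q\<^sup>2)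
      = (c * p + of_real \<theta> * q)\<^sup>2 + (c * q - of_real \<theta> * p)\<^sup>2"
    by (simp add: power2_eq_square algebra_simps)
  also have "\<dots> = 1" using q by simp
  finally show ?thesis by (metis dvd_triv_left)
qed

lemma removable_imp_mu_unit:
  assumes "removable c"
  shows "entire_calc mu c dvd 1"
  unfolding mu_eq_exp_quot
proof (intro mu_unit not_in_spec_imp_unit notI)
  fix k :: int assume k: "k \<noteq> 0" "Complex 0 (2 * pi * of_int k) \<in> spec c"
  have "exp (Complex 0 (2 * pi * of_int k)) = 1"
    by (simp add: exp_eq_1)
  then have "Complex 0 (2 * pi * of_int k) = 0" using assms k(2) by (simp add: removable_def)
  then show False using k(1) by (simp add: complex_eq_iff)
qed

lemma alg_inv_right:
  assumes "a dvd 1"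
  shows "a * alg_inv a = 1"
proof -
  obtain b where b: "a * b = 1" using assms by (metis dvd_def)
  have "b' = b" if "a * b' = 1" for b'
    using unit_mult_left_cancel[OF assms, of b' b] that b by simp
  then show ?thesis unfolding alg_inv_def using theI[of "\<lambda>b. a * b = 1" b] b by blast
qed

text \<open>\<open>removable\<close> keeps the nonzero points \<open>2 pi i k\<close> out of the
  spectrum, so that \<open>entire_calc mu (gamma S u)\<close> can be inverted. The ray form belongs
  to \<open>gamma S u = 0\<close>, where the curve is the ray \<open>t u\<close>.\<close>

theorem theorem5p2:
  fixes S N :: "'a::{banach, real_normed_algebra_1, comm_ring_1} \<Rightarrow> 'a" and u :: 'a
  assumes S_cont: "continuous_on UNIV S"
    and zero_one: "0 \<in> G_star S" "1 \<in> G_star S"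
    and S_diff: "\<And>x. S differentiable (at x)"
    and S_eq: "\<And>x y. x \<in> G_star S \<Longrightarrow> y \<in> G_star S \<Longrightarrow> S (x + S x * y) = S x * S y"
    and N_cont: "continuous_on (G_star S) N"
    and N_eq: "\<And>x y. x \<in> G_star S \<Longrightarrow> y \<in> G_star S \<Longrightarrow> N (x + S x * y) = N x + S x * N y"
    and nonsep: "\<not> separates_0_inf (spec (gamma S u))"
  shows
    \<comment> \<open>the arguments of \<open>N\<close> lie in its domain\<close>
    "(\<forall>t\<ge>0. u * entire_calc (exp_quot t) (gamma S u) \<in> G_star S)
     \<and>
     \<comment> \<open>the quotients \<open>lam S u t\<close> are well defined\<close>
     (1 \<notin> exp ` spec (gamma S u) \<longrightarrow> exp (gamma S u) - 1 \<in> alg_units)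
     \<and>
     (1 \<in> exp ` spec (gamma S u) \<and> removable (gamma S u) \<longrightarrow>
        entire_calc mu (gamma S u) \<in> alg_units)
     \<and>
     (removable (gamma S u) \<longrightarrow>
        (\<forall>t\<ge>0. N (u * entire_calc (exp_quot t) (gamma S u)) =
                 lam S u t * N (u * entire_calc (exp_quot 1) (gamma S u))))
     \<and>
     (gamma S u = 0 \<longrightarrow> (\<forall>t\<ge>0. N (t *\<^sub>R u) = t *\<^sub>R N u))
     \<and>
     \<comment> \<open>without any restriction on the spectrum, the identity with the denominator cleared\<close>
     (\<forall>t\<ge>0. entire_calc mu (gamma S u) * N (u * entire_calc (exp_quot t) (gamma S u)) =
              entire_calc (exp_quot t) (gamma S u) * N (u * entire_calc (exp_quot 1) (gamma S u)))
     \<and>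
     \<comment> \<open>the exponential tilting map\<close>
     tilt S u = u * entire_calc (exp_quot 1) (gamma S u)
     \<and>
     (\<forall>t\<ge>0. tilt S (t *\<^sub>R u) = u * entire_calc (exp_quot t) (gamma S u))
     \<and>
     (u \<in> G_one S \<and> removable (gamma S u) \<longrightarrow> entire_calc mu (gamma S u) \<in> alg_units)
     \<and>
     (removable (gamma S u) \<longrightarrow>
        (\<forall>t\<ge>0. tilt S (t *\<^sub>R u) = lam S u t * tilt S u
               \<and> N (tilt S (t *\<^sub>R u)) = N (lam S u t * tilt S u)
               \<and> N (lam S u t * tilt S u) = lam S u t * N (tilt S u)))"
proof -
  define c where "c = gamma S u"
  define \<phi> where "\<phi> = (\<lambda>t. entire_calc (exp_quot t) c)"
  have fold_\<phi>: "entire_calc (exp_quot t) c = \<phi> t" for t by (simp add: \<phi>_def)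
  have mu: "entire_calc mu c = \<phi> 1" by (simp add: \<phi>_def mu_eq_exp_quot)
  have S_curve: "S (u * \<phi> t) = exp (t *\<^sub>R c)" if "t \<ge> 0" for t
    unfolding \<phi>_def c_def using S_cont zero_one(1) S_diff
    by (rule S_along_curve) (use that in \<open>auto intro: S_eq\<close>)
  have dom: "u * \<phi> t \<in> G_star S" if "t \<ge> 0" for t
    using S_curve[OF that] exp_unit by (simp add: G_star_def alg_units_def)
  have unit_mu: "\<phi> 1 dvd 1" if "removable c"
    using removable_imp_mu_unit[OF that] by (simp add: mu)
  \<comment> \<open>Since \<open>exp 0 = 1\<close>, the spectrum omits 0; so \<open>c\<close> is a
    unit, and with it \<open>exp c - 1 = c \<phi> 1\<close>.\<close>
  have regular: "removable c \<and> c dvd 1" if "1 \<notin> exp ` spec c"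
  proof
    show "removable c" using that unfolding removable_def by force
    have "Complex 0 0 = 0" by (simp add: complex_eq_iff)
    then have "Complex 0 0 \<notin> spec c" using that by (metis exp_zero image_eqI)
    then show "c dvd 1" using not_in_spec_imp_unit[of 0 c] by (simp add: power2_eq_square unit_mult_iff)
  qed
  have exp_eq: "exp c - 1 = c * \<phi> 1" using exp_quot_times_arg[of c 1] by (simp add: \<phi>_def)
  have unit_exp: "exp c - 1 dvd 1" if "1 \<notin> exp ` spec c"
    using regular[OF that] unit_mu by (simp add: exp_eq unit_mult_iff)
  \<comment> \<open>Both branches of \<open>lam\<close> amount to
    \<open>\<phi> t / \<phi> 1\<close>; in the exponential one a common factor \<open>c\<close>
    cancels.\<close>
  have lam: "lam S u t * \<phi> 1 = \<phi> t" if "removable c" for t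
  proof (cases "1 \<in> exp ` spec c")
    case True
    then have "lam S u t * \<phi> 1 = \<phi> t * (\<phi> 1 * alg_inv (\<phi> 1))"
      by (simp add: lam_def c_def[symmetric] mu \<phi>_def mult_ac)
    then show ?thesis using alg_inv_right[OF unit_mu[OF that]] by simp
  next
    case False
    then have "lam S u t * \<phi> 1 = (c * \<phi> t) * alg_inv (exp c - 1) * \<phi> 1"
      by (simp add: lam_def c_def[symmetric] \<phi>_def exp_quot_times_arg)
    also have "\<dots> = \<phi> t * ((exp c - 1) * alg_inv (exp c - 1))"
      unfolding exp_eq by (simp add: mult_ac)
    finally show ?thesis using alg_inv_right[OF unit_exp[OF False]] by simp
  qed
  have N_curve: "\<phi> 1 * N (u * \<phi> t) = \<phi> t * N (u * \<phi> 1)" if "t \<ge> 0" for t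
    unfolding \<phi>_def
  proof (rule exp_cocycle_proportional[OF _ _ that])
    have "continuous_on {0..} (\<lambda>t. u * \<phi> t)"
      unfolding \<phi>_def
      by (intro continuous_intros continuous_at_imp_continuous_on ballI)
         (rule has_vector_derivative_continuous[OF exp_quot_has_vector_derivative])
    then show "continuous_on {0..} (\<lambda>t. N (u * entire_calc (exp_quot t) c))"
      unfolding fold_\<phi>
      by (rule continuous_on_compose2[OF N_cont]) (use dom in auto)
  next
    fix s t :: real assume st: "s \<ge> 0" "t \<ge> 0"
    have "u * \<phi> (s + t) = u * \<phi> s + S (u * \<phi> s) * (u * \<phi> t)"
      unfolding S_curve[OF st(1)] by (simp add: \<phi>_def exp_quot_add algebra_simps)
    then show "N (u * entire_calc (exp_quot (s + t)) c)
      = N (u * entire_calc (exp_quot s) c) + exp (s *\<^sub>R c) * N (u * entire_calc (exp_quot t) c)"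
      using N_eq[OF dom[OF st(1)] dom[OF st(2)]] S_curve[OF st(1)] by (simp add: \<phi>_def)
  qed
  have N_lam: "N (u * \<phi> t) = lam S u t * N (u * \<phi> 1)" if "removable c" "t \<ge> 0" for t
  proof (rule unit_mult_left_cancel[OF unit_mu[OF that(1)]])
    show "\<phi> 1 * N (u * \<phi> t) = \<phi> 1 * (lam S u t * N (u * \<phi> 1))"
      using N_curve[OF that(2)] lam[OF that(1), of t] by (metis mult.assoc mult.commute)
  qed
  have tilt1: "tilt S u = u * \<phi> 1" by (simp add: tilt_def c_def[symmetric] mu)
  have "gamma S (t *\<^sub>R u) = t *\<^sub>R c" for t
    unfolding gamma_def c_def using linear_frechet_derivative[OF S_diff] linear_cmul by blast
  then have tilt: "tilt S (t *\<^sub>R u) = u * \<phi> t" for t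
    unfolding tilt_def mu_eq_exp_quot \<phi>_def scale_exp_quot[symmetric, of t] by simp
  have zero: "N (t *\<^sub>R u) = t *\<^sub>R N u" if "c = 0" "t \<ge> 0" for t
    using N_curve[OF that(2)] that(1)
    by (simp add: \<phi>_def exp_quot_zero_arg scaleR_conv_of_real mult.commute)
  have tilt_lam: "u * \<phi> t = lam S u t * (u * \<phi> 1)" if "removable c" for t
    using lam[OF that, of t] by (metis mult.left_commute)
  have N_tilt: "N (u * \<phi> t) = N (lam S u t * (u * \<phi> 1))"
    "N (lam S u t * (u * \<phi> 1)) = lam S u t * N (u * \<phi> 1)" if "removable c" "t \<ge> 0" for t
    using N_lam[OF that] by (simp_all only: tilt_lam[OF that(1), symmetric])
  show ?thesis
    unfolding c_def[symmetric] tilt1 tilt mu fold_\<phi> alg_units_def mem_Collect_eq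
    by (intro conjI allI impI; (elim conjE)?)
       (rule refl | erule dom | erule unit_exp | erule unit_mu | erule (1) N_lam | erule (1) zero
         | erule N_curve | erule (1) N_tilt | erule tilt_lam)+
qed

end
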